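(* Assume $\Sigma_s=I_p$. For any $\lambda_t>0$ such that $\sum_{i=1}^pc_i\neq0$ (with $c_i=c_i(\lambda_t)$), one has $\mathcal R^\star_{\mathsf{pmsd}}(\lambda_t,\lambda_s)<\mathcal R(\lambda_t)$ for all $\lambda_s>0$.
   Context: Let $p,n_t,n_s$ be positive integers, $\gamma_t=p/n_t$, $\gamma_s=p/n_s$, $\overline{\mathrm{tr}}(A)=\mathrm{tr}(A)/p$. Let $\Sigma_t,\Sigma_s\in\mathbb R^{p\times p}$ be positive definite and simultaneously diagonalizable, with $\Sigma_t=U^\top\mathrm{diag}(\sigma_1,\dots,\sigma_p)U$, $U$ orthogonal. Let $\beta\in\mathbb R^p$, $\sigma^2\ge0$, $v_i=((U\beta)_i)^2$. For $\lambda_t,\lambda_s>0$ let $\kappa_t,\kappa_s>0$ be the unique positive solutions of $\kappa_t=\lambda_t+\gamma_t\kappa_t\overline{\mathrm{tr}}(\Sigma_t(\Sigma_t+\kappa_tI_p)^{-1})$ and $\kappa_s=\lambda_s+\gamma_s\kappa_s\overline{\mathrm{tr}}(\Sigma_s(\Sigma_s+\kappa_sI_p)^{-1})$. Set $G_t=(\Sigma_t+\kappa_tI_p)^{-1}$, $G_s=(\Sigma_s+\kappa_sI_p)^{-1}$, $q_{i,j}=\beta^\top G_t^iG_s^j\Sigma_t\beta$, $\tilde q_{i,j}=\beta^\top G_t^iG_s^j\Sigma_s\beta$, $t_{i,j}=\gamma_t\overline{\mathrm{tr}}(\Sigma_t^2G_t^iG_s^j)$, $b_t=(1-t_{2,0})^{-1}$,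 $b_s=\gamma_s\overline{\mathrm{tr}}(\Sigma_s\Sigma_tG_s^2)/(1-\gamma_s\overline{\mathrm{tr}}(\Sigma_s^2G_s^2))$. The limiting teacher risk, residual correlation, and pure-distilled student risk are $$\mathcal R(\lambda_t)=\sigma^2+\kappa_t^2b_tq_{2,0}+\sigma^2b_tt_{2,0},\qquad \mathcal C(\lambda_t,\lambda_s)=\mathcal R(\lambda_t)-\kappa_s\big(-\kappa_tq_{1,1}+\kappa_t^2q_{2,1}+\kappa_t^2b_tt_{2,1}q_{2,0}+\sigma^2b_tt_{2,1}\big),$$ $$\mathcal R_{\mathrm{pd}}(\lambda_s)=\kappa_s^2\Big(q_{0,2}+b_s\tilde q_{0,2}-2\kappa_t(q_{1,2}+b_s\tilde q_{1,2})+\kappa_t^2(q_{2,2}+b_s\tilde q_{2,2})+b_t(\kappa_t^2q_{2,0}+\sigma^2)\big(t_{2,2}+b_s\gamma_t\overline{\mathrm{tr}}(\Sigma_t\Sigma_sG_t^2G_s^2)\big)\Big)-\mathcal R(\lambda_t)+2\mathcal C(\lambda_t,\lambda_s),$$ and the limiting optimal prediction-mixed risk is $$\mathcal R^\star_{\mathsf{pmsd}}(\lambda_t,\lambda_s)=\mathcal R(\lambda_t)-\frac{(\mathcal R(\lambda_t)-\mathcal C(\lambda_t,\lambda_s))^2}{\mathcal R(\lambda_t)+\mathcal R_{\mathrm{pd}}(\lambda_s)-2\mathcal C(\lambda_t,\lambda_s)},$$ defined whenever its denominator is positive (which is the case when $\|\beta\|_2^2+\sigma^2>0$). Define $$c_i=\frac{\kappa_t\sigma_i^2}{(\sigma_i+\kappa_t)^2}\Big(\frac{\kappa_t^2b_tq_{2,0}+\sigma^2b_t}{\kappa_tn_t}-v_i\Big),\qquad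 i=1,\dots,p.$$ *)

theory Defs
  imports "HOL-Analysis.Analysis"
begin

(* The ring operations that HOL-Analysis puts on the type of vectors are
   componentwise, so the operator ^ would not give matrix powers. *)
primrec mat_pow :: "real^'p^'p \<Rightarrow> nat \<Rightarrow> real^'p^'p" where
  "mat_pow A 0 = mat 1"
| "mat_pow A (Suc k) = A ** mat_pow A k"

definition diag_mat :: "real^'p \<Rightarrow> real^'p^'p" where
  "diag_mat d = (\<chi> i j. if i = j then d $ i else 0)"

definition pos_def_mat :: "real^'p^'p \<Rightarrow> bool" where
  "pos_def_mat A \<longleftrightarrow> transpose A = A \<and> (\<forall>x. x \<noteq> 0 \<longrightarrow> x \<bullet> (A *v x) > 0)"

definition norm_trace :: "real^'p^'p \<Rightarrow> real" where
  "norm_trace A = trace A / real CARD('p)"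

definition resolvent :: "real^'p^'p \<Rightarrow> real \<Rightarrow> real^'p^'p" where
  "resolvent A k = matrix_inv (A + k *\<^sub>R mat 1)"

definition eff_ridge :: "real \<Rightarrow> real^'p^'p \<Rightarrow> real \<Rightarrow> real" where
  "eff_ridge gam A lam =
     (THE k. k > 0 \<and> k = lam + gam * k * norm_trace (A ** resolvent A k))"

(* The locale only fixes parameters and makes no assumptions. Outside it, a
   constant such as distillation.risk takes, in the order listed here, exactly
   those parameters on which it depends. Here var_noise stands for the noise
   variance, and sig for the vector of eigenvalues of Sigma_t with respect to U. *)
locale distillation =
  fixes n_t n_s :: nat
    and Sigma_t Sigma_s U :: "real^'p^'p"
    and sig \<beta> :: "real^'p"
    and var_noise lam_t lam_s :: real
begin

definition kappa_t :: real where
  "kappa_t = eff_ridge (real CARD('p) / real n_t) Sigma_t lam_t"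

definition kappa_s :: real where
  "kappa_s = eff_ridge (real CARD('p) / real n_s) Sigma_s lam_s"

definition G_t :: "real^'p^'p" where
  "G_t = resolvent Sigma_t kappa_t"

definition G_s :: "real^'p^'p" where
  "G_s = resolvent Sigma_s kappa_s"

definition q :: "nat \<Rightarrow> nat \<Rightarrow> real" where
  "q i j = \<beta> \<bullet> ((mat_pow G_t i ** mat_pow G_s j ** Sigma_t) *v \<beta>)"

definition q_tilde :: "nat \<Rightarrow> nat \<Rightarrow> real" where
  "q_tilde i j = \<beta> \<bullet> ((mat_pow G_t i ** mat_pow G_s j ** Sigma_s) *v \<beta>)"

(* q20 and t20 are q 2 0 and t 2 0 without the trivial factor
   mat_pow G_s 0 = mat 1, so that the teacher risk does not carry the student's
   parameters. *)
definition q20 :: real where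
  "q20 = \<beta> \<bullet> ((mat_pow G_t 2 ** Sigma_t) *v \<beta>)"

definition t20 :: real where
  "t20 = real CARD('p) / real n_t * norm_trace (mat_pow Sigma_t 2 ** mat_pow G_t 2)"

definition t :: "nat \<Rightarrow> nat \<Rightarrow> real" where
  "t i j = real CARD('p) / real n_t *
     norm_trace (mat_pow Sigma_t 2 ** mat_pow G_t i ** mat_pow G_s j)"

definition b_t :: real where
  "b_t = inverse (1 - t20)"

definition b_s :: real where
  "b_s = real CARD('p) / real n_s * norm_trace (Sigma_s ** Sigma_t ** mat_pow G_s 2) /
     (1 - real CARD('p) / real n_s * norm_trace (mat_pow Sigma_s 2 ** mat_pow G_s 2))"

definition risk :: real where
  "risk = var_noise + kappa_t\<^sup>2 * b_t * q20 + var_noise * b_t * t20"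

definition corr :: real where
  "corr = risk - kappa_s * (- kappa_t * q 1 1 + kappa_t\<^sup>2 * q 2 1
     + kappa_t\<^sup>2 * b_t * t 2 1 * q20 + var_noise * b_t * t 2 1)"

definition risk_pd :: real where
  "risk_pd = kappa_s\<^sup>2 *
     (q 0 2 + b_s * q_tilde 0 2
      - 2 * kappa_t * (q 1 2 + b_s * q_tilde 1 2)
      + kappa_t\<^sup>2 * (q 2 2 + b_s * q_tilde 2 2)
      + b_t * (kappa_t\<^sup>2 * q20 + var_noise) *
        (t 2 2 + b_s * (real CARD('p) / real n_t) *
           norm_trace (Sigma_t ** Sigma_s ** mat_pow G_t 2 ** mat_pow G_s 2)))
     - risk + 2 * corr"

(* Meaningful only if the denominator is positive. A strict inequality
   risk_pmsd < risk implies this: the numerator is a square, x / 0 = 0, and a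
   nonpositive denominator would give risk_pmsd >= risk. *)
definition risk_pmsd :: real where
  "risk_pmsd = risk - (risk - corr)\<^sup>2 / (risk + risk_pd - 2 * corr)"

definition v :: "'p \<Rightarrow> real" where
  "v i = ((U *v \<beta>) $ i)\<^sup>2"

definition c :: "'p \<Rightarrow> real" where
  "c i = kappa_t * (sig $ i)\<^sup>2 / (sig $ i + kappa_t)\<^sup>2 *
     ((kappa_t\<^sup>2 * b_t * q20 + var_noise * b_t) / (kappa_t * real n_t) - v i)"

end

end

theory Submission
  imports Defs
begin

text \<open>
  Since \<open>\<Sigma>\<^sub>s = I\<close>, every matrix in the problem is diagonal in the orthonormal basis
  given by \<open>U\<close>, so that all traces and quadratic forms become sums over the eigenvalues
  \<open>s\<^sub>i\<close> of \<open>\<Sigma>\<^sub>t\<close>, weighted by \<open>v\<^sub>i\<close> in the case of quadratic forms.  Write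
  \<open>g\<^sub>i = 1 / (s\<^sub>i + \<kappa>\<^sub>t)\<close> and \<open>h = 1 / (1 + \<kappa>\<^sub>s)\<close>; the student's resolvent is the
  scalar matrix \<open>h I\<close>, which factors out of every sum.  The identity
  \<open>\<kappa>\<^sub>t g\<^sub>i - 1 = - s\<^sub>i g\<^sub>i\<close> then gives \<open>risk - corr = \<kappa>\<^sub>s h \<Sum>\<^sub>i c\<^sub>i\<close>,
  which is nonzero by hypothesis (lemma \<open>risk_minus_corr\<close>), and it turns the
  denominator \<open>risk + risk_pd - 2 corr\<close> into \<open>\<kappa>\<^sub>s\<^sup>2 h\<^sup>2\<close> times a sum of terms that are
  nonnegative because \<open>b\<^sub>s \<ge> 0\<close> and \<open>b\<^sub>t > 0\<close> (lemma \<open>denominator_eq\<close>).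

  Both signs come from the fixed-point equations: they say that
  \<open>(1/n) \<Sum>\<^sub>i s\<^sub>i / (s\<^sub>i + \<kappa>) = 1 - \<lambda> / \<kappa> < 1\<close>, and squaring the summands, which lie in
  \<open>(0, 1)\<close>, makes the sum smaller still.  If the denominator vanished, then all
  \<open>v\<^sub>i\<close> and the noise level would be zero, hence all \<open>c\<^sub>i\<close> too, against the
  hypothesis (lemma \<open>denominator_pos\<close>).  So a positive quantity is subtracted from the teacher risk.
\<close>

section \<open>Matrices diagonal in a common orthonormal basis\<close>

definition spectral_mat :: "real^'p^'p \<Rightarrow> ('p \<Rightarrow> real) \<Rightarrow> real^'p^'p" where
  "spectral_mat U f = transpose U ** diag_mat (\<chi> i. f i) ** U"

lemma diag_mat_mult:
  "diag_mat (\<chi> i. f i) ** diag_mat (\<chi> i. g i) = diag_mat (\<chi> i. f i * g i)"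
proof -
  have "(\<Sum>k\<in>UNIV. (if i = k then f i else 0) * (if k = j then g k else 0))
      = (\<Sum>k\<in>UNIV. if k = i then if i = j then f i * g i else 0 else 0)" for i j
    by (intro sum.cong) auto
  thus ?thesis
    by (simp add: diag_mat_def matrix_matrix_mult_def vec_eq_iff cong: if_cong)
qed

lemma spectral_mat_mult:
  assumes "orthogonal_matrix U"
  shows "spectral_mat U f ** spectral_mat U g = spectral_mat U (\<lambda>i. f i * g i)"
proof -
  have "spectral_mat U f ** spectral_mat U g
      = transpose U ** diag_mat (\<chi> i. f i) ** (U ** transpose U) ** diag_mat (\<chi> i. g i) ** U"
    by (simp add: spectral_mat_def matrix_mul_assoc)
  also have "\<dots> = transpose U ** (diag_mat (\<chi> i. f i) ** diag_mat (\<chi> i. g i)) ** U"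
    using assms by (simp add: orthogonal_matrix_def matrix_mul_assoc)
  finally show ?thesis
    by (simp add: diag_mat_mult spectral_mat_def)
qed

lemma spectral_mat_const:
  fixes U :: "real^'n^'n"
  assumes "orthogonal_matrix U"
  shows "spectral_mat U (\<lambda>_. a) = a *\<^sub>R mat 1"
proof -
  have "diag_mat (\<chi> i. a) = a *\<^sub>R (mat 1 :: real^'n^'n)"
    by (simp add: diag_mat_def mat_def vec_eq_iff)
  thus ?thesis
    using assms
    by (simp add: spectral_mat_def orthogonal_matrix_def matrix_scalar_ac)
      (simp flip: scalar_matrix_assoc)
qed

lemma spectral_mat_add:
  "spectral_mat U f + spectral_mat U g = spectral_mat U (\<lambda>i. f i + g i)"
proof -
  have "diag_mat (\<chi> i. f i + g i) = diag_mat (\<chi> i. f i) + diag_mat (\<chi> i. g i)"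
    by (simp add: diag_mat_def vec_eq_iff)
  thus ?thesis
    by (simp only: spectral_mat_def matrix_add_ldistrib)
      (simp add: matrix_matrix_mult_def vec_eq_iff distrib_right sum.distrib)
qed

lemma mat_pow_spectral_mat:
  assumes "orthogonal_matrix U"
  shows "mat_pow (spectral_mat U f) k = spectral_mat U (\<lambda>i. f i ^ k)"
  using spectral_mat_const[OF assms, of 1]
  by (induction k) (simp_all add: spectral_mat_mult[OF assms])

lemma quadratic_form_spectral_mat:
  "x \<bullet> (spectral_mat U f *v x) = (\<Sum>i\<in>UNIV. f i * ((U *v x) $ i)\<^sup>2)"
proof -
  have diag: "(diag_mat (\<chi> i. f i) *v y) $ i = f i * y $ i" for y i
    by (simp add: diag_mat_def matrix_vector_mult_def if_distrib[of "\<lambda>a. a * _"] cong: if_cong)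
  have "spectral_mat U f *v x = transpose U *v (diag_mat (\<chi> i. f i) *v (U *v x))"
    by (simp only: spectral_mat_def matrix_vector_mul_assoc matrix_mul_assoc)
  also have "x \<bullet> \<dots> = (U *v x) \<bullet> (diag_mat (\<chi> i. f i) *v (U *v x))"
    by (metis dot_lmul_matrix transpose_matrix_vector inner_commute)
  finally have "x \<bullet> (spectral_mat U f *v x) = (U *v x) \<bullet> (diag_mat (\<chi> i. f i) *v (U *v x))" .
  thus ?thesis
    by (simp add: inner_vec_def diag power2_eq_square mult_ac)
qed

lemma trace_spectral_mat:
  assumes "orthogonal_matrix U"
  shows "trace (spectral_mat U f) = (\<Sum>i\<in>UNIV. f i)"
proof -
  have "trace (spectral_mat U f) = trace (U ** (transpose U ** diag_mat (\<chi> i. f i)))"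
    unfolding spectral_mat_def by (rule trace_mul_sym)
  also have "\<dots> = trace (diag_mat (\<chi> i. f i))"
    using assms by (simp add: matrix_mul_assoc orthogonal_matrix_def)
  finally show ?thesis
    by (simp add: trace_def diag_mat_def)
qed

lemma matrix_inv_unique_right:
  fixes A B :: "real^'n^'n"
  assumes "A ** B = mat 1"
  shows "matrix_inv A = B"
proof -
  have "B ** A = mat 1"
    using assms by (rule matrix_left_right_inverse1)
  with assms have "\<exists>A'. A ** A' = mat 1 \<and> A' ** A = mat 1"
    by blast
  hence inv: "matrix_inv A ** A = mat 1"
    unfolding matrix_inv_def by (rule someI2_ex) blast
  have "matrix_inv A = matrix_inv A ** (A ** B)"
    by (simp add: assms)
  also have "\<dots> = B"
    by (simp add: matrix_mul_assoc inv)
  finally show ?thesis .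
qed

lemma resolvent_spectral_mat:
  assumes U: "orthogonal_matrix U" and A: "A = spectral_mat U f" and nz: "\<And>i. f i + k \<noteq> 0"
  shows "resolvent A k = spectral_mat U (\<lambda>i. 1 / (f i + k))"
proof -
  have "A + k *\<^sub>R mat 1 = spectral_mat U (\<lambda>i. f i + k)"
    by (simp add: A spectral_mat_add flip: spectral_mat_const[OF U])
  moreover have "spectral_mat U (\<lambda>i. f i + k) ** spectral_mat U (\<lambda>i. 1 / (f i + k)) = mat 1"
    using spectral_mat_const[OF U, of 1] by (simp add: spectral_mat_mult[OF U] nz)
  ultimately show ?thesis
    unfolding resolvent_def by (intro matrix_inv_unique_right) simp
qed

lemma spectral_mat_pos_def_imp_pos:
  fixes U :: "real^'p^'p"
  assumes U: "orthogonal_matrix U" and pd: "pos_def_mat (spectral_mat U f)"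
  shows "f i > 0"
proof -
  define x where "x = transpose U *v axis i 1"
  have Ux: "U *v x = axis i 1"
    using U unfolding x_def matrix_vector_mul_assoc by (simp add: orthogonal_matrix_def)
  hence "x \<noteq> 0"
    by (metis axis_eq_0_iff matrix_vector_mult_0_right zero_neq_one)
  hence "0 < x \<bullet> (spectral_mat U f *v x)"
    using pd by (simp add: pos_def_mat_def)
  also have "\<dots> = (\<Sum>j\<in>UNIV. if j = i then f i else 0)"
    unfolding quadratic_form_spectral_mat Ux by (intro sum.cong) (auto simp: axis_def)
  finally show ?thesis by simp
qed

section \<open>The effective ridge parameter\<close>

text \<open>
  After division by \<open>k\<close> the right-hand side of the fixed-point equation is strictly
  decreasing, so there is at most one solution.  One exists by the intermediate value
  theorem between \<open>\<lambda>\<close> and \<open>\<lambda> + a \<Sum>\<^sub>i s\<^sub>i\<close>, because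
  \<open>0 \<le> k s\<^sub>i / (s\<^sub>i + k) \<le> s\<^sub>i\<close>.
\<close>
lemma ex1_ridge_fixed_point:
  fixes s :: "'i::finite \<Rightarrow> real"
  assumes s: "\<And>i. s i > 0" and a: "a \<ge> 0" and lam: "lam > 0"
  shows "\<exists>!k. k > 0 \<and> k = lam + a * k * (\<Sum>i\<in>UNIV. s i / (s i + k))"
proof (rule ex_ex1I)
  define F where "F k = k - lam - a * k * (\<Sum>i\<in>UNIV. s i / (s i + k))" for k
  define top where "top = lam + a * (\<Sum>i\<in>UNIV. s i)"
  have S: "(\<Sum>i\<in>UNIV. s i) \<ge> 0"
    using s by (simp add: sum_nonneg less_imp_le)
  have top: "lam \<le> top"
    using a S by (simp add: top_def)
  have nz: "s i + k \<noteq> 0" if "lam \<le> k" for i k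
    using s[of i] lam that by linarith
  have lo: "F lam \<le> 0"
    using s a lam by (simp add: F_def sum_nonneg less_imp_le)
  have "top * (\<Sum>i\<in>UNIV. s i / (s i + top)) = (\<Sum>i\<in>UNIV. top * s i / (s i + top))"
    by (simp add: sum_distrib_left)
  also have "\<dots> \<le> (\<Sum>i\<in>UNIV. s i)"
  proof (rule sum_mono)
    fix i
    show "top * s i / (s i + top) \<le> s i"
      using s[of i] lam top by (simp add: field_simps)
  qed
  finally have "a * (top * (\<Sum>i\<in>UNIV. s i / (s i + top))) \<le> a * (\<Sum>i\<in>UNIV. s i)"
    using a by (rule mult_left_mono)
  hence hi: "F top \<ge> 0"
    by (simp add: F_def mult.assoc) (simp add: top_def)
  have "continuous_on {lam..top} F"
    unfolding F_def using nz by (intro continuous_intros) auto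
  then obtain k where "lam \<le> k" "F k = 0"
    using IVT'[of F lam 0 top] lo hi top by blast
  thus "\<exists>k. k > 0 \<and> k = lam + a * k * (\<Sum>i\<in>UNIV. s i / (s i + k))"
    using lam by (intro exI[of _ k]) (simp add: F_def)
next
  fix k l
  assume k: "k > 0 \<and> k = lam + a * k * (\<Sum>i\<in>UNIV. s i / (s i + k))"
    and l: "l > 0 \<and> l = lam + a * l * (\<Sum>i\<in>UNIV. s i / (s i + l))"
  define H where "H x = lam / x + a * (\<Sum>i\<in>UNIV. s i / (s i + x))" for x
  have H: "H x = 1" if "x > 0 \<and> x = lam + a * x * (\<Sum>i\<in>UNIV. s i / (s i + x))" for x
  proof -
    have "x * H x = lam + a * x * (\<Sum>i\<in>UNIV. s i / (s i + x))"
      using that by (simp add: H_def distrib_left mult_ac)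
    thus ?thesis using that by simp
  qed
  have "H y < H x" if "0 < x" "x < y" for x y
  proof -
    have "s i / (s i + y) \<le> s i / (s i + x)" for i
      using that s[of i] by (intro divide_left_mono mult_pos_pos) auto
    hence "a * (\<Sum>i\<in>UNIV. s i / (s i + y)) \<le> a * (\<Sum>i\<in>UNIV. s i / (s i + x))"
      using a by (intro mult_left_mono sum_mono)
    moreover have "lam / y < lam / x"
      using that lam by (simp add: divide_strict_left_mono)
    ultimately show ?thesis by (simp add: H_def)
  qed
  from this[of k l] this[of l k] H[OF k] H[OF l] k l show "k = l"
    by linarith
qed

lemma card_times_norm_trace:
  fixes U :: "real^'p^'p"
  assumes "orthogonal_matrix U"
  shows "real CARD('p) * norm_trace (spectral_mat U f) = (\<Sum>i\<in>UNIV. f i)"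
  by (simp add: norm_trace_def trace_spectral_mat[OF assms])

lemma eff_ridge_spectral_mat:
  fixes U :: "real^'p^'p" and n :: nat
  assumes U: "orthogonal_matrix U" and A: "A = spectral_mat U s"
    and s: "\<And>i. s i > 0" and lam: "lam > 0"
  defines "k \<equiv> eff_ridge (real CARD('p) / real n) A lam"
  shows "k > 0" and "k = lam + k * (\<Sum>i\<in>UNIV. s i / (s i + k)) / real n"
proof -
  let ?P = "\<lambda>k. k > 0 \<and> k = lam + (1 / real n) * k * (\<Sum>i\<in>UNIV. s i / (s i + k))"
  have eq: "real CARD('p) / real n * x *
        norm_trace (A ** resolvent A x)
      = (1 / real n) * x * (\<Sum>i\<in>UNIV. s i / (s i + x))" if "x > 0" for x
  proof -
    have "s i + x \<noteq> 0" for i using s[of i] that by linarith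
    hence "A ** resolvent A x = spectral_mat U (\<lambda>i. s i / (s i + x))"
      by (simp add: resolvent_spectral_mat[OF U A]) (simp add: A spectral_mat_mult[OF U])
    thus ?thesis
      by (simp add: norm_trace_def trace_spectral_mat[OF U])
  qed
  have "(x > 0 \<and> x = lam + real CARD('p) / real n * x * norm_trace (A ** resolvent A x)) = ?P x" for x
    using eq[of x] by metis
  hence k: "k = (THE k. ?P k)"
    unfolding k_def eff_ridge_def by presburger
  have "\<exists>!k. ?P k"
    using s lam by (intro ex1_ridge_fixed_point) auto
  hence P: "?P k"
    unfolding k by (rule theI')
  thus "k > 0" ..
  have "(1 / real n) * k * (\<Sum>i\<in>UNIV. s i / (s i + k))
      = k * (\<Sum>i\<in>UNIV. s i / (s i + k)) / real n"
    by simp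
  with P show "k = lam + k * (\<Sum>i\<in>UNIV. s i / (s i + k)) / real n"
    by argo
qed

text \<open>
  This is the bound behind the positivity of \<open>1 - t20\<close> and of the denominator of \<open>b_s\<close>:
  each ratio lies in \<open>(0, 1)\<close>, so the sum of squares is at most the plain sum, which is
  \<open>n (1 - \<lambda> / k)\<close>.
\<close>
lemma ridge_fixed_point_squares_less_one:
  fixes s :: "'i::finite \<Rightarrow> real"
  assumes s: "\<And>i. s i > 0" and lam: "lam > 0" and k: "k > 0"
    and fp: "k = lam + k * (\<Sum>i\<in>UNIV. s i / (s i + k)) / real n"
  shows "(\<Sum>i\<in>UNIV. (s i / (s i + k))\<^sup>2) / real n < 1"
proof -
  have "(s i / (s i + k))\<^sup>2 \<le> s i / (s i + k)" for i
    using power_decreasing[of 1 2 "s i / (s i + k)"] s[of i] k by simp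
  hence "(\<Sum>i\<in>UNIV. (s i / (s i + k))\<^sup>2) / real n \<le> (\<Sum>i\<in>UNIV. s i / (s i + k)) / real n"
    by (intro divide_right_mono sum_mono) auto
  also have "\<dots> < 1"
  proof (rule ccontr)
    assume "\<not> (\<Sum>i\<in>UNIV. s i / (s i + k)) / real n < 1"
    hence "k * 1 \<le> k * ((\<Sum>i\<in>UNIV. s i / (s i + k)) / real n)"
      using k by (intro mult_left_mono) auto
    thus False using fp lam by simp
  qed
  finally show ?thesis .
qed

section \<open>Risks for an isotropic student\<close>

locale isotropic_distillation = distillation +
  assumes orth: "orthogonal_matrix U"
    and teacher: "Sigma_t = spectral_mat U (($) sig)"
    and sig_pos: "\<And>i. sig $ i > 0"
    and student: "Sigma_s = mat 1"
    and n_t_pos: "n_t > 0"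
    and noise_nonneg: "var_noise \<ge> 0"
    and lam_t_pos: "lam_t > 0" and lam_s_pos: "lam_s > 0"
begin

lemma student_spectral: "Sigma_s = spectral_mat U (\<lambda>_. 1)"
  using spectral_mat_const[OF orth, of 1] by (simp add: student)

lemma kappa_t_pos: "kappa_t > 0"
  unfolding kappa_t_def by (rule eff_ridge_spectral_mat(1)[OF orth teacher sig_pos lam_t_pos])

lemma kappa_s_pos: "kappa_s > 0"
  unfolding kappa_s_def
  by (rule eff_ridge_spectral_mat(1)[OF orth student_spectral _ lam_s_pos]) simp

definition g :: "'a \<Rightarrow> real" where "g i = 1 / (sig $ i + kappa_t)"

definition h :: real where "h = 1 / (1 + kappa_s)"

lemma g_pos: "g i > 0"
  using sig_pos[of i] kappa_t_pos by (simp add: g_def)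

lemma h_pos: "h > 0"
  using kappa_s_pos by (simp add: h_def)

lemma kappa_t_times_g: "kappa_t * g i = 1 - sig $ i * g i"
proof -
  have "sig $ i + kappa_t \<noteq> 0"
    using sig_pos[of i] kappa_t_pos by linarith
  thus ?thesis by (simp add: g_def field_simps)
qed

lemma G_t_spectral: "G_t = spectral_mat U g"
proof -
  have "sig $ i + kappa_t \<noteq> 0" for i
    using sig_pos[of i] kappa_t_pos by linarith
  thus ?thesis
    unfolding G_t_def by (simp add: resolvent_spectral_mat[OF orth teacher] g_def[abs_def])
qed

lemma G_s_spectral: "G_s = spectral_mat U (\<lambda>_. h)"
  unfolding G_s_def using kappa_s_pos
  by (subst resolvent_spectral_mat[OF orth student_spectral]) (auto simp: h_def)

lemmas spectral_simps =
  mat_pow_spectral_mat[OF orth] spectral_mat_mult[OF orth]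
  quadratic_form_spectral_mat card_times_norm_trace[OF orth]

text \<open>
  These equations are substituted in two stages: \<open>G_t\<close> and \<open>G_s\<close> depend on the
  covariance matrices as parameters, and rewriting those first would hide the resolvents.
\<close>
lemmas resolvents = G_t_spectral G_s_spectral
lemmas covariances = teacher student_spectral

lemma q_eq: "q i j = h ^ j * (\<Sum>l\<in>UNIV. g l ^ i * sig $ l * v l)"
  unfolding q_def resolvents
  by (simp add: v_def covariances spectral_simps sum_distrib_left mult_ac)

lemma q_tilde_eq: "q_tilde i j = h ^ j * (\<Sum>l\<in>UNIV. g l ^ i * v l)"
  unfolding q_tilde_def resolvents
  by (simp add: v_def covariances spectral_simps sum_distrib_left mult_ac)

lemma t_eq: "t i j = h ^ j * (\<Sum>l\<in>UNIV. (sig $ l)\<^sup>2 * g l ^ i) / real n_t"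
  unfolding t_def resolvents
  by (simp add: covariances spectral_simps sum_distrib_left mult_ac)

lemma q20_eq: "q20 = (\<Sum>l\<in>UNIV. (g l)\<^sup>2 * sig $ l * v l)"
  unfolding q20_def resolvents
  by (simp add: v_def covariances spectral_simps)

lemma t20_eq: "t20 = (\<Sum>l\<in>UNIV. (sig $ l * g l)\<^sup>2) / real n_t"
  unfolding t20_def resolvents
  by (simp add: covariances spectral_simps power_mult_distrib)

lemma v_nonneg: "v i \<ge> 0"
  by (simp add: v_def)

lemma b_t_pos: "b_t > 0"
proof -
  have fp: "kappa_t = lam_t + kappa_t *
      (\<Sum>i\<in>UNIV. sig $ i / (sig $ i + kappa_t)) / real n_t"
    unfolding kappa_t_def
    by (rule eff_ridge_spectral_mat(2)[OF orth teacher sig_pos lam_t_pos])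
  have "t20 < 1"
    using ridge_fixed_point_squares_less_one[OF sig_pos lam_t_pos kappa_t_pos fp]
    by (simp add: t20_eq g_def)
  thus ?thesis by (simp add: b_t_def)
qed

lemma b_s_nonneg: "b_s \<ge> 0"
proof -
  have fp: "kappa_s = lam_s + kappa_s * (\<Sum>i\<in>(UNIV::'a set). 1 / (1 + kappa_s)) / real n_s"
    unfolding kappa_s_def
    by (rule eff_ridge_spectral_mat(2)[OF orth student_spectral _ lam_s_pos]) simp
  have "(\<Sum>i\<in>(UNIV::'a set). h\<^sup>2) / real n_s < 1"
    unfolding h_def by (rule ridge_fixed_point_squares_less_one[OF _ lam_s_pos kappa_s_pos fp]) simp
  hence "1 - real CARD('a) / real n_s * norm_trace (mat_pow Sigma_s 2 ** mat_pow G_s 2) > 0"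
    unfolding resolvents by (simp add: covariances spectral_simps)
  moreover have "real CARD('a) / real n_s * norm_trace (Sigma_s ** Sigma_t ** mat_pow G_s 2) \<ge> 0"
    unfolding resolvents using sig_pos by (simp add: covariances spectral_simps sum_nonneg less_imp_le)
  ultimately show ?thesis
    unfolding b_s_def by (intro divide_nonneg_pos)
qed

text \<open>
  This is the teacher risk divided by the sample size, because \<open>1 + b_t * t20 = b_t\<close>.
  It is the common coefficient of the variance terms in \<open>corr\<close>, \<open>risk_pd\<close> and \<open>c\<close>.
\<close>
definition w :: real where
  "w = b_t * (kappa_t\<^sup>2 * q20 + var_noise) / real n_t"

lemma w_nonneg: "w \<ge> 0"
  using b_t_pos noise_nonneg g_pos sig_pos v_nonneg
  by (simp add: w_def q20_eq sum_nonneg less_imp_le)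

lemma c_eq: "c i = (sig $ i * g i)\<^sup>2 * (w - kappa_t * v i)"
proof -
  let ?x = "kappa_t\<^sup>2 * b_t * q20 + var_noise * b_t"
  have "c i = (sig $ i)\<^sup>2 / (sig $ i + kappa_t)\<^sup>2 * (kappa_t * (?x / (kappa_t * real n_t) - v i))"
    by (simp add: c_def)
  also have "(sig $ i)\<^sup>2 / (sig $ i + kappa_t)\<^sup>2 = (sig $ i * g i)\<^sup>2"
    by (simp add: g_def power_divide)
  also have "kappa_t * (?x / (kappa_t * real n_t) - v i) = ?x / real n_t - kappa_t * v i"
    using kappa_t_pos by (simp add: right_diff_distrib)
  also have "?x = b_t * (kappa_t\<^sup>2 * q20 + var_noise)"
    by algebra
  finally show ?thesis
    by (simp only: w_def)
qed

text \<open>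
  The bias part contributes \<open>\<kappa>\<^sub>t\<^sup>2 g\<^sup>2 - \<kappa>\<^sub>t g = - \<kappa>\<^sub>t s g\<^sup>2\<close>, so that it combines with the
  variance part into the common weight \<open>s\<^sup>2 g\<^sup>2\<close> of \<open>c\<close>.
\<close>
lemma risk_minus_corr: "risk - corr = kappa_s * h * (\<Sum>i\<in>UNIV. c i)"
proof -
  have bias: "kappa_t\<^sup>2 * (g i)\<^sup>2 - kappa_t * g i = - kappa_t * sig $ i * (g i)\<^sup>2" for i
    using kappa_t_times_g[of i] by algebra
  have c: "c i = (kappa_t\<^sup>2 * (g i)\<^sup>2 - kappa_t * g i) * (sig $ i * v i)
      + w * ((sig $ i)\<^sup>2 * (g i)\<^sup>2)" for i
    unfolding c_eq bias by (simp add: power2_eq_square algebra_simps)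
  have sum: "(\<Sum>i\<in>UNIV. c i)
      = kappa_t\<^sup>2 * (\<Sum>i\<in>UNIV. (g i)\<^sup>2 * sig $ i * v i) - kappa_t * (\<Sum>i\<in>UNIV. g i * sig $ i * v i)
        + w * (\<Sum>i\<in>UNIV. (sig $ i)\<^sup>2 * (g i)\<^sup>2)"
    unfolding c by (simp add: sum.distrib sum_subtractf sum_distrib_left algebra_simps)
  have "kappa_s * h * (\<Sum>i\<in>UNIV. c i)
      = kappa_s * (- kappa_t * q 1 1 + kappa_t\<^sup>2 * q 2 1 + w * real n_t * t 2 1)"
    unfolding sum using n_t_pos by (simp add: q_eq t_eq algebra_simps)
  also have "w * real n_t = b_t * (kappa_t\<^sup>2 * q20 + var_noise)"
    using n_t_pos by (simp add: w_def)
  finally show ?thesis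
    by (simp add: corr_def algebra_simps)
qed

text \<open>
  On each eigenvector the three bias terms form the square \<open>(1 - \<kappa>\<^sub>t g)\<^sup>2 = (s g)\<^sup>2\<close>; the weight \<open>s + b_s\<close>
  pairs each quantity with its analogue for the covariance of the student.
\<close>
lemma denominator_eq:
  "risk + risk_pd - 2 * corr =
     (kappa_s * h)\<^sup>2 * (\<Sum>i\<in>UNIV. (sig $ i + b_s) * sig $ i * (g i)\<^sup>2 * (sig $ i * v i + w))"
proof -
  have sq: "1 - 2 * kappa_t * g i + kappa_t\<^sup>2 * (g i)\<^sup>2 = (sig $ i)\<^sup>2 * (g i)\<^sup>2" for i
    using kappa_t_times_g[of i] by algebra
  have tr: "real CARD('a) / real n_t *
      norm_trace (Sigma_t ** Sigma_s ** mat_pow G_t 2 ** mat_pow G_s 2)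
      = h\<^sup>2 * (\<Sum>i\<in>UNIV. sig $ i * (g i)\<^sup>2) / real n_t"
    unfolding resolvents by (simp add: covariances spectral_simps sum_distrib_left mult_ac)
  let ?q = "\<lambda>j. \<Sum>i\<in>UNIV. g i ^ j * sig $ i * v i" and ?r = "\<lambda>j. \<Sum>i\<in>UNIV. g i ^ j * v i"
  let ?T = "\<Sum>i\<in>UNIV. (sig $ i)\<^sup>2 * (g i)\<^sup>2" and ?T' = "\<Sum>i\<in>UNIV. sig $ i * (g i)\<^sup>2"
  have summand: "(sig $ i + b_s) * sig $ i * (g i)\<^sup>2 * (sig $ i * v i + w)
      = (sig $ i + b_s) * v i * (1 - 2 * kappa_t * g i + kappa_t\<^sup>2 * (g i)\<^sup>2)
        + w * ((sig $ i)\<^sup>2 * (g i)\<^sup>2 + b_s * (sig $ i * (g i)\<^sup>2))" for i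
    unfolding sq by (simp add: power2_eq_square algebra_simps)
  have sum: "(\<Sum>i\<in>UNIV. (sig $ i + b_s) * sig $ i * (g i)\<^sup>2 * (sig $ i * v i + w))
      = ?q 0 + b_s * ?r 0 - 2 * kappa_t * (?q 1 + b_s * ?r 1) + kappa_t\<^sup>2 * (?q 2 + b_s * ?r 2)
        + w * (?T + b_s * ?T')"
    unfolding summand by (simp add: sum.distrib sum_subtractf sum_distrib_left algebra_simps)
  have "risk + risk_pd - 2 * corr = kappa_s\<^sup>2 *
     (q 0 2 + b_s * q_tilde 0 2
      - 2 * kappa_t * (q 1 2 + b_s * q_tilde 1 2)
      + kappa_t\<^sup>2 * (q 2 2 + b_s * q_tilde 2 2)
      + b_t * (kappa_t\<^sup>2 * q20 + var_noise) *
        (t 2 2 + b_s * (real CARD('a) / real n_t *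
           norm_trace (Sigma_t ** Sigma_s ** mat_pow G_t 2 ** mat_pow G_s 2))))"
    by (simp add: risk_pd_def mult.assoc)
  also have "\<dots> = (kappa_s * h)\<^sup>2 *
      (?q 0 + b_s * ?r 0 - 2 * kappa_t * (?q 1 + b_s * ?r 1) + kappa_t\<^sup>2 * (?q 2 + b_s * ?r 2)
        + w * (?T + b_s * ?T'))"
    unfolding tr q_eq q_tilde_eq t_eq w_def
    by (simp add: power_mult_distrib add_divide_distrib algebra_simps)
  finally show ?thesis unfolding sum .
qed

lemma denominator_pos:
  assumes c: "(\<Sum>i\<in>UNIV. c i) \<noteq> 0"
  shows "risk + risk_pd - 2 * corr > 0"
proof -
  obtain i where "c i \<noteq> 0"
    using c by (metis sum.neutral)
  hence "w - kappa_t * v i \<noteq> 0"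
    by (auto simp: c_eq)
  hence "w > 0 \<or> v i > 0"
    using w_nonneg v_nonneg[of i] by (cases "w = 0") auto
  hence "sig $ i * v i + w > 0"
    using sig_pos[of i] v_nonneg[of i] w_nonneg by (auto intro: add_nonneg_pos add_pos_nonneg)
  hence pos: "(sig $ i + b_s) * sig $ i * (g i)\<^sup>2 * (sig $ i * v i + w) > 0"
    using sig_pos[of i] g_pos[of i] b_s_nonneg by (intro mult_pos_pos) auto
  have "(sig $ j + b_s) * sig $ j * (g j)\<^sup>2 * (sig $ j * v j + w) \<ge> 0" for j
    using sig_pos[of j] v_nonneg[of j] w_nonneg b_s_nonneg by simp
  with pos have "(\<Sum>i\<in>UNIV. (sig $ i + b_s) * sig $ i * (g i)\<^sup>2 * (sig $ i * v i + w)) > 0"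
    by (intro sum_pos2[of _ i]) auto
  thus ?thesis
    unfolding denominator_eq using kappa_s_pos h_pos by simp
qed

lemma risk_pmsd_less_risk:
  assumes "(\<Sum>i\<in>UNIV. c i) \<noteq> 0"
  shows "risk_pmsd < risk"
proof -
  have "risk - corr \<noteq> 0"
    using assms kappa_s_pos h_pos by (simp add: risk_minus_corr)
  thus ?thesis
    using denominator_pos[OF assms] by (simp add: risk_pmsd_def)
qed

end

theorem mainTheorem7:
  fixes n_t n_s :: nat
    and Sigma_t Sigma_s U :: "real^'p^'p"
    and sig sig' \<beta> :: "real^'p"
    and var_noise lam_t :: real
  assumes "n_t > 0" and "n_s > 0"
    and "pos_def_mat Sigma_t" and "pos_def_mat Sigma_s"
    and "orthogonal_matrix U"
    and "Sigma_t = transpose U ** diag_mat sig ** U"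
    and "Sigma_s = transpose U ** diag_mat sig' ** U"
    and "var_noise \<ge> 0"
    and "Sigma_s = mat 1"
    and "lam_t > 0"
    and "(\<Sum>i\<in>UNIV. distillation.c n_t Sigma_t U sig \<beta> var_noise lam_t i) \<noteq> 0"
  shows "\<forall>lam_s>0. distillation.risk_pmsd n_t n_s Sigma_t Sigma_s \<beta> var_noise lam_t lam_s
                    < distillation.risk n_t Sigma_t \<beta> var_noise lam_t"
proof (intro allI impI)
  fix lam_s :: real
  assume "lam_s > 0"
  have teacher: "Sigma_t = spectral_mat U (($) sig)"
    using assms(6) by (simp add: spectral_mat_def)
  interpret isotropic_distillation n_t n_s Sigma_t Sigma_s U sig \<beta> var_noise lam_t lam_s
    using assms \<open>lam_s > 0\<close> spectral_mat_pos_def_imp_pos[of U "($) sig"]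
    by unfold_locales (auto simp: teacher)
  show "distillation.risk_pmsd n_t n_s Sigma_t Sigma_s \<beta> var_noise lam_t lam_s
      < distillation.risk n_t Sigma_t \<beta> var_noise lam_t"
    using assms(11) by (rule risk_pmsd_less_risk)
qed

end
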